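(* Let $\mathbb{F}$ be a finite field and $n\ge 1$. Let $\mathcal{B}\subset\mathbb{F}^n[[z,z^{-1}]]$ be a behavior, i.e. a linear, time-invariant and complete subset, and put $\mathcal{C}:=\mathcal{B}\cap\mathbb{F}^n((z))$. Then $\mathcal{C}$ is an $\mathbb{F}((z))$-linear subspace of $\mathbb{F}^n((z))$ having a basis of rational vectors in $\mathbb{F}^n(z)$, and its completion (closure) $\bar{\mathcal{C}}$ in $\mathbb{F}^n[[z,z^{-1}]]$ is the largest controllable sub-behavior of $\mathcal{B}$ (that is, the largest controllable behavior contained in $\mathcal{B}$). Moreover, the assignment $\mathcal{B}\mapsto\mathcal{B}\cap\mathbb{F}^n((z))$ gives a bijective correspondence between the controllable behaviors $\mathcal{B}\subset\mathbb{F}^n[[z,z^{-1}]]$ and the $\mathbb{F}((z))$-linear subspaces of $\mathbb{F}^n((z))$ that have a basis of rational vectors in $\mathbb{F}^n(z)$.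
   Context: $\mathbb{F}^n[[z,z^{-1}]]$ denotes the set of all formal two-sided series $w(z)=\sum_{i=-\infty}^{\infty}w_iz^i$ with $w_i\in\mathbb{F}^n$, identified with $(\mathbb{F}^n)^{\mathbb{Z}}$. $\mathbb{F}((z))$ is the field of formal Laurent series $\sum_{i=d}^\infty a_iz^i$ with $d\in\mathbb{Z}$. The field of rational functions $\mathbb{F}(z)$ is viewed as a subfield of $\mathbb{F}((z))$ by Laurent expansion at $z=0$, and $\mathbb{F}^n(z)\subset\mathbb{F}^n((z))\subset\mathbb{F}^n[[z,z^{-1}]]$ accordingly. The left shift is $\sigma:w(z)\mapsto z^{-1}w(z)$, and it acts componentwise on $\mathbb{F}^n[[z,z^{-1}]]$. A subset $\mathcal{B}\subset\mathbb{F}^n[[z,z^{-1}]]$ is linear if it is an $\mathbb{F}$-linear subspace, and time-invariant if $\sigma(\mathcal{B})=\mathcal{B}$. It is complete if every $w\in\mathbb{F}^n[[z,z^{-1}]]$ such that $w|_J\in\mathcal{B}|_J$ for every finite subinterval $J\subset\mathbb{Z}$ belongs to $\mathcal{B}$. Here $w|_J=(w_i)_{i\in J}$ and $\mathcal{B}|_J=\{v|_J\mid v\in\mathcal{B}\}$. A behavior means a linear, time-invariant and complete subset of $\mathbb{F}^n[[z,z^{-1}]]$. The topology on $\mathbb{F}^n[[z,z^{-1}]]$ is induced by the metric $d(v(z),w(z))=\sum_{i\in\mathbb{Z}}2^{-|i|}d_H(v_i,w_i)$, where $d_H$ is the Hamming distance on $\mathbb{F}^n$. The completion $\bar{\mathcal{C}}$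 is the closure of $\mathcal{C}$ in this topology. For $w=\sum_iw_iz^i$ write $w^+=\sum_{i\ge 0}w_iz^i$ and $w^-=\sum_{i\le 0}w_iz^i$. A behavior $\mathcal{B}$ is controllable if there is some integer $\ell$ (of either sign) such that for every $w,w'\in\mathcal{B}$ and every integer $j$ there exists $w''\in\mathcal{B}$ with $(z^jw'')^-=(z^jw)^-$ and $(z^{j+\ell}w'')^+=(z^{j+\ell}w')^+$. *)

theory Defs
  imports "HOL-Analysis.Analysis" "HOL-Computational_Algebra.Computational_Algebra"
    "HOL-Library.Function_Algebras"
begin

unbundle no Formal_Power_Series.fps_syntax

text \<open>The vector \<open>w i\<close> is the coefficient of \<open>z^i\<close> in the two-sided series \<open>w\<close>.\<close>

type_synonym ('a, 'n) biseries = "int \<Rightarrow> ('a, 'n) vec"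

definition scale_biseries :: "'a::field \<Rightarrow> ('a, 'n::finite) biseries \<Rightarrow> ('a, 'n) biseries"
  where "scale_biseries c w = (\<lambda>i. c *s w i)"

global_interpretation biseries: vector_space scale_biseries
  by unfold_locales
    (simp_all add: scale_biseries_def fun_eq_iff vec_eq_iff algebra_simps)

definition zpow_mult :: "int \<Rightarrow> ('a::field, 'n::finite) biseries \<Rightarrow> ('a, 'n) biseries"
  where "zpow_mult k w = (\<lambda>i. w (i - k))"

definition left_shift :: "('a::field, 'n::finite) biseries \<Rightarrow> ('a, 'n) biseries"
  where "left_shift = zpow_mult (- 1)"

definition time_invariant :: "('a::field, 'n::finite) biseries set \<Rightarrow> bool"
  where "time_invariant B \<longleftrightarrow> left_shift ` B = B"

text \<open>The finite subintervals of \<open>\<int>\<close> are the sets \<open>{a..b}\<close>.\<close>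

definition complete_system :: "('a::field, 'n::finite) biseries set \<Rightarrow> bool"
  where "complete_system B \<longleftrightarrow>
    (\<forall>w. (\<forall>a b. restrict w {a..b} \<in> (\<lambda>v. restrict v {a..b}) ` B) \<longrightarrow> w \<in> B)"

definition behavior :: "('a::field, 'n::finite) biseries set \<Rightarrow> bool"
  where "behavior B \<longleftrightarrow> biseries.subspace B \<and> time_invariant B \<and> complete_system B"

definition plus_part :: "('a::field, 'n::finite) biseries \<Rightarrow> ('a, 'n) biseries"
  where "plus_part w = (\<lambda>i. if i \<ge> 0 then w i else 0)"

definition minus_part :: "('a::field, 'n::finite) biseries \<Rightarrow> ('a, 'n) biseries"
  where "minus_part w = (\<lambda>i. if i \<le> 0 then w i else 0)"

definition controllable :: "('a::field, 'n::finite) biseries set \<Rightarrow> bool"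
  where "controllable B \<longleftrightarrow>
    (\<exists>l::int. \<forall>w\<in>B. \<forall>w'\<in>B. \<forall>j::int. \<exists>w''\<in>B.
      minus_part (zpow_mult j w'') = minus_part (zpow_mult j w) \<and>
      plus_part (zpow_mult (j + l) w'') = plus_part (zpow_mult (j + l) w'))"

definition hamming_dist :: "'a ^ 'n::finite \<Rightarrow> 'a ^ 'n \<Rightarrow> nat"
  where "hamming_dist x y = card {k. x $ k \<noteq> y $ k}"

definition biseries_dist :: "('a::field, 'n::finite) biseries \<Rightarrow> ('a, 'n) biseries \<Rightarrow> real"
  where "biseries_dist v w = (\<Sum>\<^sub>\<infinity>i. 2 powi (- \<bar>i\<bar>) * real (hamming_dist (v i) (w i)))"

lemma hamming_dist_le: "hamming_dist (x :: 'a ^ 'n::finite) y \<le> CARD('n)"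
  unfolding hamming_dist_def by (rule card_mono) auto

lemma summable_powi_abs: "(\<lambda>i::int. (2::real) powi (- \<bar>i\<bar>)) summable_on UNIV"
proof -
  have g: "(\<lambda>n::nat. (1/2::real) ^ n) summable_on UNIV"
    by (intro summable_nonneg_imp_summable_on) (auto simp: summable_geometric)
  have a: "(\<lambda>i::int. (2::real) powi (- \<bar>i\<bar>)) summable_on range int"
    by (subst summable_on_reindex)
      (use g in \<open>simp_all add: o_def power_int_minus power_one_over inverse_eq_divide\<close>)
  have b: "(\<lambda>i::int. (2::real) powi (- \<bar>i\<bar>)) summable_on range (\<lambda>n. - int n)"
    by (subst summable_on_reindex)
      (use g in \<open>simp_all add: inj_def o_def power_int_minus power_one_over inverse_eq_divide\<close>)
  have "range int \<union> range (\<lambda>n. - int n) = UNIV"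
  proof (rule UNIV_eq_I[symmetric])
    fix i :: int
    show "i \<in> range int \<union> range (\<lambda>n. - int n)"
      by (cases i rule: int_cases2) auto
  qed
  then show ?thesis
    using summable_on_union[OF a b] by simp
qed

lemma summable_biseries_dist:
  fixes v w :: "('a::field, 'n::finite) biseries"
  shows "(\<lambda>i. 2 powi (- \<bar>i\<bar>) * real (hamming_dist (v i) (w i))) summable_on UNIV"
proof (rule summable_on_comparison_test)
  show "(\<lambda>i::int. (2::real) powi (- \<bar>i\<bar>) * real CARD('n)) summable_on UNIV"
    by (intro summable_on_cmult_left summable_powi_abs)
qed (auto intro!: mult_left_mono hamming_dist_le)

lemma hamming_dist_eq_0: "hamming_dist x y = 0 \<longleftrightarrow> x = y"
  by (auto simp: hamming_dist_def vec_eq_iff)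

lemma hamming_dist_commute: "hamming_dist x y = hamming_dist y x"
  unfolding hamming_dist_def by (rule arg_cong[where f = card]) auto

lemma hamming_dist_triangle: "hamming_dist x z \<le> hamming_dist x y + hamming_dist y z"
proof -
  have "hamming_dist x z \<le> card ({k. x $ k \<noteq> y $ k} \<union> {k. y $ k \<noteq> z $ k})"
    unfolding hamming_dist_def by (rule card_mono) auto
  also have "\<dots> \<le> hamming_dist x y + hamming_dist y z"
    unfolding hamming_dist_def by (rule card_Un_le)
  finally show ?thesis .
qed

global_interpretation biseries_metric:
  Metric_space "UNIV :: ('a::field, 'n::finite) biseries set" biseries_dist
proof
  fix u v w :: "('a, 'n) biseries"
  show "0 \<le> biseries_dist v w"
    unfolding biseries_dist_def by (intro infsum_nonneg) auto
  show "biseries_dist v w = biseries_dist w v"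
    unfolding biseries_dist_def by (subst hamming_dist_commute) (rule refl)
  show "biseries_dist v w = 0 \<longleftrightarrow> v = w"
  proof
    assume z: "biseries_dist v w = 0"
    have "2 powi (- \<bar>i\<bar>) * real (hamming_dist (v i) (w i)) = 0" for i
      by (rule nonneg_infsum_le_0D[of _ UNIV])
        (use z summable_biseries_dist[of v w] in \<open>auto simp: biseries_dist_def\<close>)
    then show "v = w"
      by (auto simp: hamming_dist_eq_0 fun_eq_iff)
  qed (simp add: biseries_dist_def hamming_dist_def)
  have "biseries_dist u w \<le> (\<Sum>\<^sub>\<infinity>i. 2 powi (- \<bar>i\<bar>) * real (hamming_dist (u i) (v i))
      + 2 powi (- \<bar>i\<bar>) * real (hamming_dist (v i) (w i)))"
    unfolding biseries_dist_def
  proof (rule infsum_mono)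
    fix i
    show "2 powi (- \<bar>i\<bar>) * real (hamming_dist (u i) (w i))
      \<le> 2 powi (- \<bar>i\<bar>) * real (hamming_dist (u i) (v i))
        + 2 powi (- \<bar>i\<bar>) * real (hamming_dist (v i) (w i))"
      unfolding distrib_left[symmetric] of_nat_add[symmetric]
      by (intro mult_left_mono of_nat_mono hamming_dist_triangle) auto
  qed (intro summable_on_add summable_biseries_dist)+
  also have "\<dots> = biseries_dist u v + biseries_dist v w"
    unfolding biseries_dist_def by (intro infsum_add summable_biseries_dist)
  finally show "biseries_dist u w \<le> biseries_dist u v + biseries_dist v w" .
qed

definition biseries_completion :: "('a::field, 'n::finite) biseries set \<Rightarrow> ('a, 'n) biseries set"
  where "biseries_completion C = biseries_metric.mtopology closure_of C"

text \<open>The inclusion of \<open>F^n((z))\<close>, whose elements are vectors of formal Laurent series, into the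
  two-sided series.\<close>

definition biseries_of_fls :: "('a::field fls) ^ 'n::finite \<Rightarrow> ('a, 'n) biseries"
  where "biseries_of_fls v = (\<lambda>i. \<chi> k. fls_nth (v $ k) i)"

lemma inj_biseries_of_fls: "inj biseries_of_fls"
  by (auto intro!: injI fls_eqI simp: biseries_of_fls_def fun_eq_iff vec_eq_iff)

text \<open>\<open>B \<inter> F^n((z))\<close>, taken as a set of vectors over \<open>F((z))\<close>.\<close>

definition laurent_part :: "('a::field, 'n::finite) biseries set \<Rightarrow> (('a fls) ^ 'n) set"
  where "laurent_part B = biseries_of_fls -` B"

lemma image_laurent_part:
  "biseries_of_fls ` laurent_part B = B \<inter> range biseries_of_fls"
  by (auto simp: laurent_part_def)

text \<open>The image of \<open>F(z)\<close> under Laurent expansion at \<open>z = 0\<close>: the quotient is formed in the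
  field \<open>F((z))\<close>.\<close>

definition rational_fls :: "'a::field fls set"
  where "rational_fls =
    {fps_to_fls (fps_of_poly p) / fps_to_fls (fps_of_poly q) | p q. q \<noteq> 0}"

definition rational_vectors :: "(('a::field fls) ^ 'n::finite) set"
  where "rational_vectors = {v. \<forall>k. v $ k \<in> rational_fls}"

definition rational_subspace :: "(('a::field fls) ^ 'n::finite) set \<Rightarrow> bool"
  where "rational_subspace C \<longleftrightarrow> vec.subspace C \<and>
    (\<exists>S \<subseteq> rational_vectors. vec.independent S \<and> vec.span S = C)"

end

theory Submission
  imports Defs
begin

text \<open>
  The proof passes between two-sided trajectories and Laurent vectors, that is, trajectories that
  are zero in the far past. Finite windows connect the two sides: completeness means that a behavior
  is determined by its finite windows, and the closure of a set consists of the series all of whose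
  finite windows occur in the set (\<open>biseries_completion_eq_window_closure\<close>).

  Let \<open>B\<close> be a behavior and \<open>C\<close> its Laurent part. That \<open>C\<close> is a subspace over \<open>F((z))\<close> is a consequence of
  completeness (\<open>subspace_laurent_part\<close>). For a rational basis, it suffices that rational vectors are
  dense in \<open>C\<close>, because subspaces of \<open>F^n((z))\<close> are closed (\<open>subspace_closed\<close>). Density rests on the
  finite memory of \<open>B\<close> (\<open>behavior_finite_memory\<close>): over a finite field the memory contents of a
  trajectory \<open>w\<close> recur after some time \<open>k\<close>, and then cutting off \<open>(1 - z^k) w\<close> at the recurrence and
  dividing by \<open>1 - z^k\<close> yields a rational element of \<open>C\<close> that agrees with \<open>w\<close> up to there
  (\<open>rational_vectors_dense\<close>).

  Conversely let \<open>C\<close> be any subspace with a rational basis. Its closure is a behavior, and it is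
  controllable: in a polynomial basis, truncating the coordinates of a trajectory steers it to zero
  within a time bounded by the degrees (\<open>controllable_completion\<close>). The closure contains no Laurent
  vectors besides those of \<open>C\<close> (\<open>laurent_part_completion\<close>); here the pigeonhole principle and division
  by \<open>1 - z^k\<close> are used once more, to get rid of a transient that the approximating elements of \<open>C\<close>
  may have in the past.

  Finally, a trajectory in a controllable behavior contained in \<open>B\<close> can be made zero in the far past
  without changing it on a given window, and so is a limit of elements of the Laurent part of \<open>B\<close>
  (\<open>controllable_subset_completion\<close>). This gives maximality, and shows that closure and Laurent part
  are inverse to each other.
\<close>

section \<open>Finite windows, completeness and closure\<close>

text \<open>A series lies in the window closure of \<open>X\<close> when every finite piece of it occurs in \<open>X\<close>. Both
  completeness and the metric closure are instances of this notion, so topology can be replaced by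
  a comparison of finite windows.\<close>
definition window_closure :: "('a::field, 'n::finite) biseries set \<Rightarrow> ('a, 'n) biseries set"
  where "window_closure X = {w. \<forall>a b. \<exists>v\<in>X. \<forall>i\<in>{a..b}. v i = w i}"

lemma window_closureI: "(\<And>a b. \<exists>v\<in>X. \<forall>i\<in>{a..b}. v i = w i) \<Longrightarrow> w \<in> window_closure X"
  by (simp add: window_closure_def)

lemma window_closureD: "w \<in> window_closure X \<Longrightarrow> \<exists>v\<in>X. \<forall>i\<in>{a..b}. v i = w i"
  by (simp add: window_closure_def)

lemma subset_window_closure: "X \<subseteq> window_closure X"
  by (auto simp: window_closure_def)

lemma window_closure_mono: "X \<subseteq> Y \<Longrightarrow> window_closure X \<subseteq> window_closure Y"
  unfolding window_closure_def by blast

lemma complete_system_iff_window_closure: "complete_system B \<longleftrightarrow> window_closure B \<subseteq> B"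
proof -
  have "restrict w A \<in> (\<lambda>v. restrict v A) ` B \<longleftrightarrow> (\<exists>v\<in>B. \<forall>i\<in>A. v i = w i)" for w A
  proof -
    have "restrict w A = restrict v A \<longleftrightarrow> (\<forall>i\<in>A. v i = w i)" for v
      by (auto simp: restrict_def fun_eq_iff)
    then show ?thesis
      by auto
  qed
  then show ?thesis
    unfolding complete_system_def window_closure_def by auto
qed

lemma complete_systemD:
  assumes "complete_system B" and "\<And>a b. \<exists>v\<in>B. \<forall>i\<in>{a..b}. v i = w i"
  shows "w \<in> B"
  using assms window_closureI[of B w] by (auto simp: complete_system_iff_window_closure)

lemma window_closure_idem: "window_closure (window_closure X) \<subseteq> window_closure X"
proof (intro subsetI window_closureI)
  fix w a b
  assume "w \<in> window_closure (window_closure X)"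
  then obtain v where v: "v \<in> window_closure X" "\<forall>i\<in>{a..b}. v i = w i"
    using window_closureD by blast
  then obtain u where "u \<in> X" "\<forall>i\<in>{a..b}. u i = v i"
    using window_closureD by blast
  with v show "\<exists>u\<in>X. \<forall>i\<in>{a..b}. u i = w i"
    by (intro bexI[of _ u]) auto
qed

text \<open>A single differing coefficient at \<open>i\<close> already contributes \<open>2 powi (- \<bar>i\<bar>)\<close> to the distance.\<close>
lemma agree_if_biseries_dist_small:
  fixes v w :: "('a::field, 'n::finite) biseries"
  assumes "biseries_dist v w < 2 powi (- \<bar>i\<bar>)"
  shows "v i = w i"
proof (rule ccontr)
  let ?f = "\<lambda>i. 2 powi (- \<bar>i\<bar>) * real (hamming_dist (v i) (w i))"
  assume "v i \<noteq> w i"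
  then have "1 \<le> real (hamming_dist (v i) (w i))"
    using hamming_dist_eq_0[of "v i" "w i"] by simp
  then have "2 powi (- \<bar>i\<bar>) * 1 \<le> ?f i"
    by (intro mult_left_mono) auto
  also have "?f i \<le> (\<Sum>\<^sub>\<infinity>j. ?f j)"
    using infsum_mono_neutral[of ?f "{i}" ?f UNIV] summable_biseries_dist[of v w] by auto
  finally show False
    using assms by (simp add: biseries_dist_def)
qed

text \<open>The weights \<open>2 powi (- \<bar>i\<bar>)\<close> are summable and Hamming distances are bounded by \<open>CARD('n)\<close>, so
  the coefficients outside a large window contribute less than \<open>e\<close> to any distance.\<close>
lemma biseries_dist_small_if_agree:
  fixes w :: "('a::field, 'n::finite) biseries"
  assumes "e > 0"
  obtains a b where "\<And>v. (\<forall>i\<in>{a..b}. v i = w i) \<Longrightarrow> biseries_dist w v < e"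
proof -
  let ?g = "\<lambda>i::int. (2::real) powi (- \<bar>i\<bar>) * real CARD('n)"
  have g: "?g summable_on UNIV"
    by (intro summable_on_cmult_left summable_powi_abs)
  then obtain A where A: "finite A" and dist: "dist (\<Sum>i\<in>A. ?g i) (infsum ?g UNIV) \<le> e / 2"
    using infsum_finite_approximation[of ?g UNIV "e / 2"] assms by auto
  obtain a b where ab: "A \<subseteq> {a..b}"
  proof (cases "A = {}")
    case False
    with A show ?thesis
      by (intro that[of "Min A" "Max A"]) auto
  qed (use that[of 0 0] in auto)
  have "infsum ?g (UNIV - A) \<le> e / 2"
    using abs_le_D2[OF dist[unfolded dist_real_def]] A g by (subst infsum_Diff) auto
  show ?thesis
  proof (rule that[of a b])
    fix v
    assume v: "\<forall>i\<in>{a..b}. v i = w i"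
    let ?f = "\<lambda>i. 2 powi (- \<bar>i\<bar>) * real (hamming_dist (w i) (v i))"
    have "biseries_dist w v = infsum ?f (UNIV - A)"
      unfolding biseries_dist_def
      using v ab by (intro infsum_cong_neutral) (auto simp: hamming_dist_def)
    also have "\<dots> \<le> infsum ?g (UNIV - A)"
      using summable_biseries_dist[of w v] g
      by (intro infsum_mono mult_left_mono of_nat_mono hamming_dist_le)
        (auto intro: summable_on_subset_banach)
    also have "\<dots> \<le> e / 2"
      by fact
    finally show "biseries_dist w v < e"
      using assms by simp
  qed
qed

lemma biseries_completion_eq_window_closure: "biseries_completion X = window_closure X"
proof (intro equalityI subsetI)
  fix w
  assume w: "w \<in> biseries_completion X"
  show "w \<in> window_closure X"
  proof (rule window_closureI)
    fix a b :: int
    let ?m = "max \<bar>a\<bar> \<bar>b\<bar>"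
    have "(2::real) powi (- ?m) > 0"
      by simp
    moreover have "\<forall>r>0. \<exists>v\<in>X. biseries_dist w v < r"
      using w unfolding biseries_completion_def biseries_metric.metric_closure_of by auto
    ultimately obtain v where v: "v \<in> X" "biseries_dist w v < 2 powi (- ?m)"
      by blast
    have "v i = w i" if "i \<in> {a..b}" for i
    proof -
      have "(2::real) powi (- ?m) \<le> 2 powi (- \<bar>i\<bar>)"
        using that by (intro power_int_increasing) auto
      with v agree_if_biseries_dist_small[of w v i] show ?thesis
        by auto
    qed
    with v show "\<exists>v\<in>X. \<forall>i\<in>{a..b}. v i = w i"
      by blast
  qed
next
  fix w
  assume w: "w \<in> window_closure X"
  have "\<exists>v\<in>X. biseries_dist w v < r" if "r > 0" for r
    using biseries_dist_small_if_agree[OF that, of w] window_closureD[OF w] by metis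
  then show "w \<in> biseries_completion X"
    unfolding biseries_completion_def biseries_metric.metric_closure_of by auto
qed

text \<open>A product of finite discrete spaces is compact, so the closures of the tails of the sequence have
  a common point.\<close>
lemma exists_cluster_biseries:
  fixes x :: "nat \<Rightarrow> ('a::{field,finite}, 'n::finite) biseries"
  shows "\<exists>w. \<forall>a b N. \<exists>m\<ge>N. \<forall>i\<in>{a..b}. x m i = w i"
proof -
  let ?X = "product_topology (\<lambda>_::int. discrete_topology (UNIV :: ('a ^ 'n) set)) UNIV"
  define C where "C N = ?X closure_of (x ` {N..})" for N
  have "compact_space ?X"
    by (simp add: compact_space_product_topology compact_space_discrete_topology)
  moreover have "C N \<noteq> {}" for N
    by (simp add: C_def closure_of_eq_empty_gen disjnt_def)
  moreover have "decseq C"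
    unfolding C_def decseq_def by (auto intro!: closure_of_mono)
  moreover have "closedin ?X (C N)" for N
    by (simp add: C_def)
  ultimately have "(\<Inter>N. C N) \<noteq> {}"
    using compact_space_imp_nest[of ?X C] by blast
  then obtain w where w: "w \<in> C N" for N
    by auto
  have "\<exists>m\<ge>N. \<forall>i\<in>{a..b}. x m i = w i" for a b N
  proof -
    let ?U = "PiE UNIV (\<lambda>i::int. if i \<in> {a..b} then {w i} else UNIV)"
    have "finite {i. (if i \<in> {a..b} then {w i} else UNIV) \<noteq> (UNIV :: ('a ^ 'n) set)}"
      by (rule finite_subset[of _ "{a..b}"]) auto
    then have "openin ?X ?U"
      by (simp add: openin_PiE_gen)
    moreover have "w \<in> ?U"
      by (auto simp: PiE_def)
    ultimately obtain y where "y \<in> x ` {N..}" "y \<in> ?U"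
      using w[of N] unfolding C_def in_closure_of by blast
    then show ?thesis
      by (auto simp: PiE_def Pi_def split: if_splits)
  qed
  then show ?thesis
    by blast
qed

section \<open>Behaviors and controllability\<close>

lemma zpow_mult_nth [simp]: "zpow_mult k w i = w (i - k)"
  by (simp add: zpow_mult_def)

lemma scale_biseries_nth [simp]: "scale_biseries c w i = c *s w i"
  by (simp add: scale_biseries_def)

lemma zpow_mult_mem:
  assumes "time_invariant B" "w \<in> B"
  shows "zpow_mult k w \<in> B"
proof (induction k rule: int_induct[where k = 0])
  case base
  have "zpow_mult 0 w = w"
    by (simp add: fun_eq_iff)
  with assms show ?case
    by simp
next
  case (step1 k)
  from step1(2) have "zpow_mult k w \<in> left_shift ` B"
    using assms(1) unfolding time_invariant_def by blast
  then obtain v where v: "v \<in> B" "zpow_mult k w = left_shift v"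
    by blast
  have "zpow_mult (k + 1) w i = v i" for i
    using fun_cong[OF v(2), of "i - 1"] by (simp add: left_shift_def algebra_simps)
  with v show ?case
    by (metis ext)
next
  case (step2 k)
  have "left_shift (zpow_mult k w) = zpow_mult (k - 1) w"
    by (simp add: left_shift_def fun_eq_iff algebra_simps)
  moreover have "left_shift (zpow_mult k w) \<in> B"
    using step2(2) assms unfolding time_invariant_def by blast
  ultimately show ?case
    by (simp only:)
qed

lemma time_invariantI:
  assumes "\<And>k w. w \<in> B \<Longrightarrow> zpow_mult k w \<in> B"
  shows "time_invariant B"
  unfolding time_invariant_def
proof (intro equalityI subsetI)
  fix w
  assume "w \<in> left_shift ` B"
  then show "w \<in> B"
    using assms by (auto simp: left_shift_def)
next
  fix w
  assume "w \<in> B"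
  moreover have "w = left_shift (zpow_mult 1 w)"
    by (simp add: left_shift_def fun_eq_iff)
  ultimately show "w \<in> left_shift ` B"
    using assms by blast
qed

lemma behavior_window_closure:
  assumes sub: "biseries.subspace X" and shift: "\<And>k w. w \<in> X \<Longrightarrow> zpow_mult k w \<in> X"
  shows "behavior (window_closure X)"
  unfolding behavior_def
proof (intro conjI biseries.subspaceI time_invariantI)
  show "0 \<in> window_closure X"
    using biseries.subspace_0[OF sub] subset_window_closure by blast
next
  fix v w
  assume v: "v \<in> window_closure X" and w: "w \<in> window_closure X"
  show "v + w \<in> window_closure X"
  proof (rule window_closureI)
    fix a b
    obtain v' w' where "v' \<in> X" "\<forall>i\<in>{a..b}. v' i = v i" "w' \<in> X" "\<forall>i\<in>{a..b}. w' i = w i"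
      using window_closureD[OF v] window_closureD[OF w] by metis
    then show "\<exists>u\<in>X. \<forall>i\<in>{a..b}. u i = (v + w) i"
      using biseries.subspace_add[OF sub] by (intro bexI[of _ "v' + w'"]) auto
  qed
next
  fix c w
  assume w: "w \<in> window_closure X"
  show "scale_biseries c w \<in> window_closure X"
  proof (rule window_closureI)
    fix a b
    obtain w' where "w' \<in> X" "\<forall>i\<in>{a..b}. w' i = w i"
      using window_closureD[OF w] by metis
    then show "\<exists>u\<in>X. \<forall>i\<in>{a..b}. u i = scale_biseries c w i"
      using biseries.subspace_scale[OF sub] by (intro bexI[of _ "scale_biseries c w'"]) auto
  qed
next
  fix k w
  assume w: "w \<in> window_closure X"
  show "zpow_mult k w \<in> window_closure X"
  proof (rule window_closureI)
    fix a b
    obtain w' where "w' \<in> X" "\<forall>i\<in>{a - k..b - k}. w' i = w i"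
      using window_closureD[OF w] by metis
    then show "\<exists>u\<in>X. \<forall>i\<in>{a..b}. u i = zpow_mult k w i"
      using shift by (intro bexI[of _ "zpow_mult k w'"]) auto
  qed
next
  show "complete_system (window_closure X)"
    by (simp add: complete_system_iff_window_closure window_closure_idem)
qed

text \<open>By linearity, passing from \<open>w\<close> to \<open>w'\<close> amounts to steering \<open>w - w'\<close> to zero. The parameters of
  the definition appear as \<open>t = - j\<close> and \<open>L = - l\<close>.\<close>
lemma controllable_iff_steerable_to_0:
  assumes sub: "biseries.subspace B"
  shows "controllable B \<longleftrightarrow>
    (\<exists>L. \<forall>w\<in>B. \<forall>t. \<exists>u\<in>B. (\<forall>i\<le>t. u i = w i) \<and> (\<forall>i\<ge>t + L. u i = 0))"
proof -
  \<comment> \<open>Evaluating at \<open>x + j\<close> undoes the multiplication by \<open>z^j\<close>.\<close>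
  have shift: "(\<forall>x. P x) \<longleftrightarrow> (\<forall>x. P (x + j))" for P and j :: int
    by (metis diff_add_cancel)
  have minus: "minus_part (zpow_mult j v) = minus_part (zpow_mult j w) \<longleftrightarrow> (\<forall>i\<le>-j. v i = w i)"
    for j and v w :: "('a, 'b) biseries"
    unfolding minus_part_def fun_eq_iff by (subst shift[of _ j]) auto
  have plus: "plus_part (zpow_mult j v) = plus_part (zpow_mult j w) \<longleftrightarrow> (\<forall>i\<ge>-j. v i = w i)"
    for j and v w :: "('a, 'b) biseries"
    unfolding plus_part_def fun_eq_iff by (subst shift[of _ j]) auto
  show ?thesis
  proof
    assume "controllable B"
    then obtain l where l: "\<And>w w' j. w \<in> B \<Longrightarrow> w' \<in> B \<Longrightarrow>
        \<exists>u\<in>B. (\<forall>i\<le>-j. u i = w i) \<and> (\<forall>i\<ge>-(j + l). u i = w' i)"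
      unfolding controllable_def minus plus by blast
    have "\<exists>u\<in>B. (\<forall>i\<le>t. u i = w i) \<and> (\<forall>i\<ge>t + (- l). u i = 0)" if "w \<in> B" for w t
      using l[OF that biseries.subspace_0[OF sub], of "- t"] by simp
    then show "\<exists>L. \<forall>w\<in>B. \<forall>t. \<exists>u\<in>B. (\<forall>i\<le>t. u i = w i) \<and> (\<forall>i\<ge>t + L. u i = 0)"
      by blast
  next
    assume "\<exists>L. \<forall>w\<in>B. \<forall>t. \<exists>u\<in>B. (\<forall>i\<le>t. u i = w i) \<and> (\<forall>i\<ge>t + L. u i = 0)"
    then obtain L where L:
      "\<And>w t. w \<in> B \<Longrightarrow> \<exists>u\<in>B. (\<forall>i\<le>t. u i = w i) \<and> (\<forall>i\<ge>t + L. u i = 0)"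
      by blast
    have "\<exists>u\<in>B. (\<forall>i\<le>-j. u i = w i) \<and> (\<forall>i\<ge>-(j + (- L)). u i = w' i)"
      if w: "w \<in> B" "w' \<in> B" for w w' j
    proof -
      obtain u where "u \<in> B" "\<forall>i\<le>-j. u i = (w - w') i" "\<forall>i\<ge>-j + L. u i = 0"
        using L[OF biseries.subspace_diff[OF sub w], of "- j"] by blast
      then show ?thesis
        using biseries.subspace_add[OF sub _ w(2)] by (intro bexI[of _ "u + w'"]) auto
    qed
    then show "controllable B"
      unfolding controllable_def minus plus by blast
  qed
qed

section \<open>Laurent vectors and their orders\<close>

definition vanishes_below :: "int \<Rightarrow> ('a::field fls) ^ 'n::finite \<Rightarrow> bool"
  where "vanishes_below N v \<longleftrightarrow> (\<forall>i<N. biseries_of_fls v i = 0)"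

lemma biseries_of_fls_nth [simp]: "biseries_of_fls v i $ k = fls_nth (v $ k) i"
  by (simp add: biseries_of_fls_def)

lemma biseries_of_fls_0 [simp]: "biseries_of_fls 0 = 0"
  by (simp add: fun_eq_iff vec_eq_iff)

lemma biseries_of_fls_add: "biseries_of_fls (u + v) = biseries_of_fls u + biseries_of_fls v"
  by (simp add: fun_eq_iff vec_eq_iff)

lemma biseries_of_fls_diff: "biseries_of_fls (u - v) = biseries_of_fls u - biseries_of_fls v"
  by (simp add: fun_eq_iff vec_eq_iff)

lemma biseries_of_fls_const: "biseries_of_fls (fls_const c *s v) = scale_biseries c (biseries_of_fls v)"
  by (simp add: fun_eq_iff vec_eq_iff)

lemma biseries_of_fls_X_intpow:
  "biseries_of_fls (fls_X_intpow k *s v) = zpow_mult k (biseries_of_fls v)"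
  by (simp add: fun_eq_iff vec_eq_iff fls_X_intpow_times_conv_shift)

lemma exists_vanishes_below: "\<exists>N. vanishes_below N v"
proof -
  let ?N = "Min (range (\<lambda>k. fls_subdegree (v $ k)))"
  have "?N \<le> fls_subdegree (v $ k)" for k
    by (intro Min_le) auto
  then have "vanishes_below ?N v"
    by (force simp: vanishes_below_def vec_eq_iff intro: fls_eq0_below_subdegree)
  then show ?thesis ..
qed

lemma biseries_of_fls_exists:
  assumes "\<And>i. i < N \<Longrightarrow> w i = 0"
  obtains v where "biseries_of_fls v = w"
proof
  have "\<exists>N. \<forall>i<N. w i $ k = 0" for k
    using assms by (intro exI[of _ N]) auto
  then show "biseries_of_fls (\<chi> k. Abs_fls (\<lambda>i. w i $ k)) = w"
    by (simp add: fun_eq_iff vec_eq_iff nth_Abs_fls_ex_lower_bound)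
qed

lemma fls_times_nth_eq_0:
  fixes f g :: "'a::field fls"
  assumes "\<And>j. fls_nth f j = 0 \<or> fls_nth g (i - j) = 0"
  shows "fls_nth (f * g) i = 0"
  unfolding fls_times_nth(2) using assms by (intro sum.neutral) (metis mult_eq_0_iff)

text \<open>Orders add under multiplication. The order is phrased by vanishing coefficients because the
  subdegree of the zero series carries no information.\<close>
lemma vanishes_below_scale:
  assumes "\<And>i. i < M \<Longrightarrow> fls_nth a i = 0" "vanishes_below N v" "K \<le> M + N"
  shows "vanishes_below K (a *s v)"
  unfolding vanishes_below_def
proof (intro allI impI)
  fix i
  assume i: "i < K"
  have "fls_nth (a * v $ k) i = 0" for k
  proof (rule fls_times_nth_eq_0)
    fix j
    have "fls_nth (v $ k) (i - j) = 0" if "M \<le> j"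
    proof -
      have "i - j < N"
        using that i assms(3) by linarith
      then show ?thesis
        using assms(2) by (metis vanishes_below_def biseries_of_fls_nth zero_index)
    qed
    then show "fls_nth a j = 0 \<or> fls_nth (v $ k) (i - j) = 0"
      using assms(1) not_le by blast
  qed
  then show "biseries_of_fls (a *s v) i = 0"
    by (simp add: vec_eq_iff)
qed

lemma vanishes_below_mono: "vanishes_below N v \<Longrightarrow> M \<le> N \<Longrightarrow> vanishes_below M v"
  by (auto simp: vanishes_below_def)

lemma eq_if_vanishes_below_diff:
  "vanishes_below N (u - v) \<Longrightarrow> i < N \<Longrightarrow> biseries_of_fls u i = biseries_of_fls v i"
  by (simp add: vanishes_below_def biseries_of_fls_diff)

text \<open>Shift invariance and linearity only give closure under Laurent polynomial scalars. A Laurent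
  series scalar \<open>a\<close> agrees with Laurent polynomials to any order, and since \<open>v\<close> is bounded on the
  left, each finite window of \<open>a *s v\<close> depends on finitely many coefficients of \<open>a\<close>. Completeness
  then puts \<open>a *s v\<close> into \<open>B\<close>.\<close>
lemma subspace_laurent_part:
  assumes "behavior B"
  shows "vec.subspace (laurent_part B)"
proof (rule vec.subspaceI)
  have sub: "biseries.subspace B" and inv: "time_invariant B" and compl: "complete_system B"
    using assms by (auto simp: behavior_def)
  show "0 \<in> laurent_part B"
    using biseries.subspace_0[OF sub] by (simp add: laurent_part_def)
  show add: "u + v \<in> laurent_part B" if "u \<in> laurent_part B" "v \<in> laurent_part B" for u v
    using that biseries.subspace_add[OF sub] by (simp add: laurent_part_def biseries_of_fls_add)
  show "a *s v \<in> laurent_part B" if v: "v \<in> laurent_part B" for a v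
  proof -
    obtain N where N: "vanishes_below N v"
      using exists_vanishes_below by blast
    define M where "M = fls_subdegree a"
    have approx: "\<exists>p. p *s v \<in> laurent_part B \<and> (\<forall>i < M + int m. fls_nth (a - p) i = 0)" for m
    proof (induction m)
      case 0
      have "0 *s v \<in> laurent_part B"
        using biseries.subspace_0[OF sub] by (simp add: laurent_part_def)
      then show ?case
        by (intro exI[of _ 0]) (simp add: M_def)
    next
      case (Suc m)
      then obtain p where p: "p *s v \<in> laurent_part B" "\<And>i. i < M + int m \<Longrightarrow> fls_nth (a - p) i = 0"
        by blast
      let ?c = "fls_nth (a - p) (M + int m)" and ?X = "fls_X_intpow (M + int m) :: 'a fls"
      have "fls_const ?c *s (?X *s v) \<in> laurent_part B"
        using v biseries.subspace_scale[OF sub] zpow_mult_mem[OF inv]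
        by (simp only: laurent_part_def vimage_def mem_Collect_eq biseries_of_fls_const biseries_of_fls_X_intpow)
      with p(1) have "(p + fls_const ?c * ?X) *s v \<in> laurent_part B"
        using add by (simp add: vec.scale_left_distrib vector_smult_assoc)
      moreover have "fls_nth (a - (p + fls_const ?c * ?X)) i = 0" if "i < M + int (Suc m)" for i
      proof (cases "i = M + int m")
        case False
        with that p(2)[of i] show ?thesis
          by simp
      qed simp
      ultimately show ?case
        by blast
    qed
    have "biseries_of_fls (a *s v) \<in> B"
    proof (rule complete_systemD[OF compl])
      fix c d :: int
      obtain p where p: "p *s v \<in> laurent_part B"
          "\<And>i. i < M + int (nat (d + 1 - M - N)) \<Longrightarrow> fls_nth (a - p) i = 0"
        using approx by blast
      have "vanishes_below (d + 1) ((a - p) *s v)"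
        by (rule vanishes_below_scale[OF p(2) N]) auto
      then have "biseries_of_fls (p *s v) i = biseries_of_fls (a *s v) i" if "i \<le> d" for i
        using that eq_if_vanishes_below_diff[of "d + 1" "a *s v" "p *s v" i]
        by (simp add: vec.scale_left_diff_distrib)
      with p(1) show "\<exists>u\<in>B. \<forall>i\<in>{c..d}. u i = biseries_of_fls (a *s v) i"
        by (intro bexI[of _ "biseries_of_fls (p *s v)"]) (auto simp: laurent_part_def)
    qed
    then show ?thesis
      by (simp add: laurent_part_def)
  qed
qed

lemma behavior_completion:
  assumes "vec.subspace C"
  shows "behavior (biseries_completion (biseries_of_fls ` C))"
  unfolding biseries_completion_eq_window_closure
proof (rule behavior_window_closure)
  show "biseries.subspace (biseries_of_fls ` C)"
  proof (rule biseries.subspaceI)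
    show "0 \<in> biseries_of_fls ` C"
      using vec.subspace_0[OF assms] biseries_of_fls_0 by (metis imageI)
    show "v + w \<in> biseries_of_fls ` C" if "v \<in> biseries_of_fls ` C" "w \<in> biseries_of_fls ` C" for v w
      using that vec.subspace_add[OF assms] by (auto simp flip: biseries_of_fls_add)
    show "scale_biseries c w \<in> biseries_of_fls ` C" if "w \<in> biseries_of_fls ` C" for c w
      using that vec.subspace_scale[OF assms] by (auto simp flip: biseries_of_fls_const)
  qed
  show "zpow_mult k w \<in> biseries_of_fls ` C" if "w \<in> biseries_of_fls ` C" for k w
    using that vec.subspace_scale[OF assms] by (auto simp flip: biseries_of_fls_X_intpow)
qed

section \<open>Finite memory\<close>

text \<open>If a trajectory is zero for \<open>M\<close> steps, then its past can be replaced by zero. Let \<open>V m\<close> be the set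
  of values at time \<open>0\<close> after \<open>m\<close> zeros. These sets decrease, hence are constant from some \<open>M\<close> on. A
  value in \<open>V M\<close> thus occurs after arbitrarily many zeros and, by compactness, after an infinite
  past of zeros. Subtracting such a trajectory from the given one lengthens the run of zeros by one
  step; iterating this and passing to the limit rebuilds the whole future of the trajectory from
  trajectories with zero past.\<close>
lemma behavior_finite_memory:
  fixes B :: "('a::{field,finite}, 'n::finite) biseries set"
  assumes "behavior B"
  obtains M :: nat where
    "\<And>u t. u \<in> B \<Longrightarrow> (\<And>i. t - int M \<le> i \<Longrightarrow> i < t \<Longrightarrow> u i = 0) \<Longrightarrow> (\<lambda>i. if i < t then 0 else u i) \<in> B"
proof -
  have sub: "biseries.subspace B" and inv: "time_invariant B" and compl: "complete_system B"
    using assms by (auto simp: behavior_def)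
  define V where "V m = {u 0 |u. u \<in> B \<and> (\<forall>i. - int m \<le> i \<and> i < 0 \<longrightarrow> u i = 0)}" for m
  \<comment> \<open>A decreasing chain of finite sets is constant from a member of least cardinality on.\<close>
  obtain M where M: "\<And>m. card (V M) \<le> card (V m)"
    using ex_has_least_nat[of "\<lambda>_. True" 0 "\<lambda>m. card (V m)"] by auto
  have V: "V M \<subseteq> V m" for m
  proof (cases "m \<le> M")
    case False
    then have "V m \<subseteq> V M"
      by (force simp: V_def)
    then have "V m = V M"
      using M by (intro card_seteq) auto
    then show ?thesis
      by simp
  qed (force simp: V_def)
  have start0: "\<exists>y\<in>B. (\<forall>i<0. y i = 0) \<and> y 0 = u 0"
    if u: "u \<in> B" "\<And>i. - int M \<le> i \<Longrightarrow> i < 0 \<Longrightarrow> u i = 0" for u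
  proof -
    have "u 0 \<in> V M"
      using u by (auto simp: V_def)
    then have "\<exists>x\<in>B. x 0 = u 0 \<and> (\<forall>i. - int m \<le> i \<and> i < 0 \<longrightarrow> x i = 0)" for m
      using V[of m] by (force simp: V_def)
    then obtain x where x: "\<And>m. x m \<in> B" "\<And>m. x m 0 = u 0"
        "\<And>m i. - int m \<le> i \<Longrightarrow> i < 0 \<Longrightarrow> x m i = 0"
      by metis
    obtain y where y: "\<And>a b N. \<exists>m\<ge>N. \<forall>i\<in>{a..b}. x m i = y i"
      using exists_cluster_biseries[of x] by blast
    have "y \<in> B"
      using y x(1) by (intro complete_systemD[OF compl]) blast
    moreover have "y i = 0" if "i < 0" for i
      using y[of "nat (- i)" i i] x(3)[of _ i] that by force
    moreover have "y 0 = u 0"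
      using y[of 0 0 0] x(2) by auto
    ultimately show ?thesis
      by blast
  qed
  have start: "\<exists>y\<in>B. (\<forall>i<s. y i = 0) \<and> y s = u s"
    if u: "u \<in> B" "\<And>i. s - int M \<le> i \<Longrightarrow> i < s \<Longrightarrow> u i = 0" for u s
  proof -
    have "zpow_mult (- s) u \<in> B"
      using zpow_mult_mem[OF inv u(1)] .
    then obtain y where "y \<in> B" "\<forall>i<0. y i = 0" "y 0 = u s"
      using start0[of "zpow_mult (- s) u"] u(2) by auto
    then show ?thesis
      using zpow_mult_mem[OF inv, of y s] by (intro bexI[of _ "zpow_mult s y"]) auto
  qed
  have "(\<lambda>i. if i < t then 0 else u i) \<in> B"
    if u: "u \<in> B" "\<And>i. t - int M \<le> i \<Longrightarrow> i < t \<Longrightarrow> u i = 0" for u t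
  proof -
    have step: "\<exists>y\<in>B. (\<forall>i<t. y i = 0) \<and> (\<forall>i. t \<le> i \<and> i < t + int m \<longrightarrow> y i = u i)" for m
    proof (induction m)
      case 0
      then show ?case
        using biseries.subspace_0[OF sub] by (intro bexI[of _ 0]) auto
    next
      case (Suc m)
      then obtain y where y: "y \<in> B" "\<forall>i<t. y i = 0" "\<forall>i. t \<le> i \<and> i < t + int m \<longrightarrow> y i = u i"
        by blast
      have "(u - y) i = 0" if "t + int m - int M \<le> i" "i < t + int m" for i
        using that y u(2)[of i] by (cases "i < t") auto
      then obtain y' where y': "y' \<in> B" "\<forall>i<t + int m. y' i = 0" "y' (t + int m) = (u - y) (t + int m)"
        using start[OF biseries.subspace_diff[OF sub u(1) y(1)], of "t + int m"] by blast
      have "(y + y') i = u i" if "t \<le> i" "i < t + int (Suc m)" for i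
        using y y' that by (cases "i = t + int m") auto
      moreover have "(y + y') i = 0" if "i < t" for i
        using y y' that by auto
      ultimately show ?case
        using biseries.subspace_add[OF sub y(1) y'(1)] by (intro bexI[of _ "y + y'"]) auto
    qed
    show ?thesis
    proof (rule complete_systemD[OF compl])
      fix a b :: int
      obtain y where "y \<in> B" "\<forall>i<t. y i = 0" "\<forall>i. t \<le> i \<and> i < t + int (nat (b + 1 - t)) \<longrightarrow> y i = u i"
        using step by blast
      then show "\<exists>v\<in>B. \<forall>i\<in>{a..b}. v i = (if i < t then 0 else u i)"
        by (intro bexI[of _ y]) auto
    qed
  qed
  with that show ?thesis .
qed

text \<open>Over a finite type there are finitely many patterns of length \<open>d\<close>, so two of
  them coincide.\<close>
lemma exists_recurrence:
  fixes f :: "nat \<Rightarrow> nat \<Rightarrow> 'b::finite"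
  shows "\<exists>N N'. N0 \<le> N \<and> N < N' \<and> (\<forall>j<d. f N j = f N' j)"
proof -
  let ?g = "\<lambda>N. map (f N) [0..<d]"
  have "finite (?g ` {N0..})"
    by (rule finite_subset[OF _ finite_lists_length_eq[of UNIV d]]) auto
  then have "\<not> inj_on ?g {N0..}"
    using finite_imageD infinite_Ici by blast
  then obtain N N' where "N0 \<le> N" "N0 \<le> N'" "N \<noteq> N'" "?g N = ?g N'"
    by (auto simp: inj_on_def)
  then show ?thesis
    by (cases "N < N'") (force intro: exI[of _ N] exI[of _ N'])+
qed

section \<open>Closed subspaces and rational vectors\<close>

text \<open>A vector outside \<open>C\<close> is separated from \<open>C\<close> by a linear map \<open>f\<close> that vanishes on \<open>C\<close>. In
  coordinates \<open>f\<close> is a matrix, whose entries have orders bounded below, so a coefficient of \<open>f w\<close>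
  depends only on coefficients of \<open>w\<close> up to a fixed index. If \<open>u \<in> C\<close> is close to \<open>v\<close>, then \<open>f v\<close> and
  \<open>f u = 0\<close> would have to agree at an index where \<open>f v\<close> is nonzero.\<close>
lemma subspace_closed:
  fixes C :: "('a::field fls ^ 'n::finite) set"
  assumes C: "vec.subspace C" and approx: "\<And>N. \<exists>u\<in>C. vanishes_below N (u - v)"
  shows "v \<in> C"
proof (rule ccontr)
  assume v: "v \<notin> C"
  obtain S where S: "S \<subseteq> C" "vec.independent S" "C \<subseteq> vec.span S"
    using vec.maximal_independent_subset[of C] by blast
  have "vec.span S = C"
    using S C vec.span_minimal by blast
  then have "vec.independent (insert v S)"
    using v S by (simp add: vec.independent_insert)
  then obtain f :: "'a fls ^ 'n \<Rightarrow> 'a fls ^ 'n" where f: "Vector_Spaces.linear (*s) (*s) f"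
      "\<forall>x\<in>insert v S. f x = (if x = v then v else 0)"
    using vec.linear_independent_extend[where f = "\<lambda>x. if x = v then v else 0"] by blast
  let ?A = "matrix f"
  have f_eq: "f x = ?A *v x" for x
    using matrix_works[OF f(1)] by simp
  have f0: "f x = 0" if "x \<in> C" for x
  proof -
    have "f x = 0" if "x \<in> vec.span S"
      using that
    proof (induction rule: vec.span_induct_alt)
      case (step c x y)
      then have "f x = 0"
        using f(2) v S by auto
      with step show ?case
        by (simp add: f_eq matrix_vector_right_distrib vec.scale)
    qed (simp add: f_eq)
    with that \<open>vec.span S = C\<close> show ?thesis
      by simp
  qed
  have "v \<noteq> 0"
    using v vec.subspace_0[OF C] by blast
  then obtain m where "f v $ m \<noteq> 0"
    using f(2) by (auto simp: vec_eq_iff)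
  then obtain i where i: "fls_nth (f v $ m) i \<noteq> 0"
    by (auto simp: fls_eq_iff)
  obtain D where D: "vanishes_below D (?A $ m)"
    using exists_vanishes_below by blast
  obtain u where u: "u \<in> C" "vanishes_below (i - D + 1) (u - v)"
    using approx by blast
  have "fls_nth (?A $ m $ k * (u - v) $ k) i = 0" for k
  proof (rule fls_times_nth_eq_0)
    fix j
    show "fls_nth (?A $ m $ k) j = 0 \<or> fls_nth ((u - v) $ k) (i - j) = 0"
    proof (cases "j < D")
      case True
      with D show ?thesis
        by (metis vanishes_below_def biseries_of_fls_nth zero_index)
    next
      case False
      then have "i - j < i - D + 1"
        by simp
      with u(2) show ?thesis
        by (metis vanishes_below_def biseries_of_fls_nth zero_index)
    qed
  qed
  then have "fls_nth (f (u - v) $ m) i = 0"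
    by (simp add: f_eq matrix_vector_mult_def fls_nth_sum)
  moreover have "f (u - v) = - f v"
    using f0[OF u(1)] by (simp add: f_eq matrix_vector_mult_diff_distrib)
  ultimately show False
    using i by simp
qed

lemma polynomial_fls_if_finite_support:
  fixes g :: "'a::field fls"
  assumes "\<And>i. i < 0 \<Longrightarrow> fls_nth g i = 0" "\<And>i. i \<ge> int D \<Longrightarrow> fls_nth g i = 0"
  obtains p where "g = fps_to_fls (fps_of_poly p)"
proof
  let ?p = "Poly (map (\<lambda>i. fls_nth g (int i)) [0..<D])"
  show "g = fps_to_fls (fps_of_poly ?p)"
    by (rule fls_eqI) (use assms in \<open>auto simp: nth_default_def\<close>)
qed

lemma rational_fls_if_bounded_support:
  fixes f :: "'a::field fls"
  assumes "\<And>i. i \<ge> T \<Longrightarrow> fls_nth f i = 0" "k > 0"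
  shows "f / (1 - fls_X ^ k) \<in> rational_fls"
proof -
  \<comment> \<open>Multiplication by \<open>z^s\<close> turns the Laurent polynomial \<open>f\<close> into a polynomial.\<close>
  define s where "s = nat (- fls_subdegree f)"
  have nth: "fls_nth (fls_X ^ s * f) i = fls_nth f (i - int s)" for i
    by (simp add: fls_X_power_times_conv_shift)
  have "fls_nth (fls_X ^ s * f) i = 0" if "i < 0" for i
  proof -
    have "i - int s < fls_subdegree f"
      using that by (simp add: s_def)
    then show ?thesis
      unfolding nth by (rule fls_eq0_below_subdegree)
  qed
  moreover have "fls_nth (fls_X ^ s * f) i = 0" if "i \<ge> int (nat (T + int s))" for i
    using that unfolding nth by (intro assms) linarith
  ultimately obtain p where p: "fls_X ^ s * f = fps_to_fls (fps_of_poly p)"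
    by (rule polynomial_fls_if_finite_support)
  let ?q = "monom 1 s * (1 - monom 1 k) :: 'a poly"
  have "coeff (1 - monom 1 k :: 'a poly) 0 \<noteq> 0"
    using assms(2) by (simp add: coeff_monom)
  then have "(1 - monom 1 k :: 'a poly) \<noteq> 0"
    by (metis coeff_0)
  then have q: "?q \<noteq> 0"
    by (simp add: monom_eq_0_iff)
  have "fps_to_fls (fps_of_poly ?q) = fls_X ^ s * (1 - fls_X ^ k)"
    by (simp add: fps_of_poly_mult fps_of_poly_diff fps_of_poly_monom fls_times_fps_to_fls
        fps_to_fls_power)
  then have "f / (1 - fls_X ^ k) = fps_to_fls (fps_of_poly p) / fps_to_fls (fps_of_poly ?q)"
    by (simp flip: p)
  with q show ?thesis
    unfolding rational_fls_def by blast
qed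

lemma one_minus_X_power:
  assumes "k > 0"
  shows one_minus_X_power_nonzero: "1 - fls_X ^ k \<noteq> (0 :: 'a::field fls)"
    and inverse_one_minus_X_power_nth: "i < 0 \<Longrightarrow> fls_nth (inverse (1 - fls_X ^ k :: 'a fls)) i = 0"
proof -
  have "fls_subdegree (1 - fls_X ^ k :: 'a fls) = 0"
    using assms by (intro fls_subdegree_eqI) auto
  then show "i < 0 \<Longrightarrow> fls_nth (inverse (1 - fls_X ^ k :: 'a fls)) i = 0"
    by (intro fls_eq0_below_subdegree) simp
  have "fls_nth (1 - fls_X ^ k :: 'a fls) 0 \<noteq> 0"
    using assms by simp
  then show "1 - fls_X ^ k \<noteq> (0 :: 'a fls)"
    by (metis fls_zero_nth)
qed

lemma biseries_of_fls_one_minus_X_power: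
  "biseries_of_fls ((1 - fls_X ^ k) *s v) i = biseries_of_fls v i - biseries_of_fls v (i - int k)"
  by (simp add: vec_eq_iff left_diff_distrib fls_X_power_times_conv_shift)

lemma vanishes_below_inverse_one_minus_X_power:
  fixes u v :: "'a::field fls ^ 'n::finite"
  assumes "k > 0" "vanishes_below N (u - (1 - fls_X ^ k) *s v)"
  shows "vanishes_below N (inverse (1 - fls_X ^ k) *s u - v)"
proof -
  have "inverse (1 - fls_X ^ k) * (1 - fls_X ^ k) = (1 :: 'a fls)"
    using one_minus_X_power_nonzero[OF assms(1)] by (rule left_inverse)
  then have "inverse (1 - fls_X ^ k) *s u - v = inverse (1 - fls_X ^ k) *s (u - (1 - fls_X ^ k) *s v)"
    by (simp only: vec.scale_right_diff_distrib vector_smult_assoc vec.scale_one)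
  moreover have "vanishes_below N (inverse (1 - fls_X ^ k) *s (u - (1 - fls_X ^ k) *s v))"
    by (rule vanishes_below_scale[OF inverse_one_minus_X_power_nth assms(2)]) (use assms(1) in auto)
  ultimately show ?thesis
    by (simp only:)
qed

text \<open>Let the same pattern of length \<open>M\<close> end just before the times \<open>t < t'\<close> in \<open>w\<close>, and let
  \<open>k = t' - t\<close>. Then \<open>x = (1 - z^k) w\<close> has \<open>M\<close> zeros before \<open>t'\<close>, so by finite memory its part \<open>e\<close> from
  \<open>t'\<close> on is a trajectory, and so is the Laurent polynomial vector \<open>x - e\<close>. Dividing by \<open>1 - z^k\<close>
  gives a rational trajectory that differs from \<open>w\<close> by \<open>e / (1 - z^k)\<close>, which starts at \<open>t'\<close>: it is \<open>w\<close>
  continued periodically from \<open>t'\<close> on.\<close>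
lemma rational_vectors_dense:
  fixes B :: "('a::{field,finite}, 'n::finite) biseries set"
  assumes B: "behavior B" and w: "w \<in> laurent_part B"
  shows "\<exists>v \<in> laurent_part B \<inter> rational_vectors. vanishes_below (int N) (v - w)"
proof -
  note C = subspace_laurent_part[OF B]
  obtain M where M: "\<And>u t. u \<in> B \<Longrightarrow> (\<And>i. t - int M \<le> i \<Longrightarrow> i < t \<Longrightarrow> u i = 0) \<Longrightarrow>
      (\<lambda>i. if i < t then 0 else u i) \<in> B"
    using behavior_finite_memory[OF B] by blast
  obtain t t' where t: "N \<le> t" "t < t'"
      "\<And>j. j < M \<Longrightarrow> biseries_of_fls w (int t - int M + int j) = biseries_of_fls w (int t' - int M + int j)"
    using exists_recurrence[of N M "\<lambda>t j. biseries_of_fls w (int t - int M + int j)"] by blast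
  define k where "k = t' - t"
  have k: "k > 0" "int k = int t' - int t"
    using t by (auto simp: k_def)
  define x where "x = (1 - fls_X ^ k) *s w"
  have x: "x \<in> laurent_part B"
    unfolding x_def by (rule vec.subspace_scale[OF C w])
  have "biseries_of_fls x i = 0" if "int t' - int M \<le> i" "i < int t'" for i
  proof -
    define j where "j = nat (i - (int t' - int M))"
    have j: "j < M" "int t - int M + int j = i - int k" "int t' - int M + int j = i"
      using that k by (auto simp: j_def)
    then show ?thesis
      using t(3)[OF j(1)] unfolding x_def biseries_of_fls_one_minus_X_power j by simp
  qed
  then have tail: "(\<lambda>i. if i < int t' then 0 else biseries_of_fls x i) \<in> B"
    using x by (intro M) (auto simp: laurent_part_def)
  obtain e where e: "biseries_of_fls e = (\<lambda>i. if i < int t' then 0 else biseries_of_fls x i)"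
    using biseries_of_fls_exists[of "int t'" "\<lambda>i. if i < int t' then 0 else biseries_of_fls x i"] by auto
  have "e \<in> laurent_part B"
    using tail by (simp add: laurent_part_def e)
  then have "inverse (1 - fls_X ^ k) *s (x - e) \<in> laurent_part B"
    using x by (intro vec.subspace_scale[OF C] vec.subspace_diff[OF C])
  moreover have "inverse (1 - fls_X ^ k) *s (x - e) \<in> rational_vectors"
  proof -
    have "fls_nth ((x - e) $ j) i = 0" if "i \<ge> int t'" for i j
      using that fun_cong[OF e, of i] by (simp add: vec_eq_iff)
    then have "(x - e) $ j / (1 - fls_X ^ k) \<in> rational_fls" for j
      by (rule rational_fls_if_bounded_support[OF _ k(1)])
    then show ?thesis
      by (simp only: rational_vectors_def mem_Collect_eq vector_smult_component divide_inverse mult.commute) simp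
  qed
  moreover have "vanishes_below (int N) (inverse (1 - fls_X ^ k) *s (x - e) - w)"
  proof (rule vanishes_below_inverse_one_minus_X_power[OF k(1)])
    have "vanishes_below (int N) (x - e - x)"
      using t unfolding vanishes_below_def biseries_of_fls_diff e by auto
    then show "vanishes_below (int N) (x - e - (1 - fls_X ^ k) *s w)"
      by (simp only: x_def)
  qed
  ultimately show ?thesis
    by blast
qed

text \<open>The rational vectors of the Laurent part span a closed subspace in which the Laurent part is
  contained by density.\<close>
lemma rational_subspace_laurent_part:
  fixes B :: "('a::{field,finite}, 'n::finite) biseries set"
  assumes "behavior B"
  shows "rational_subspace (laurent_part B)"
proof -
  note C = subspace_laurent_part[OF assms]
  let ?R = "laurent_part B \<inter> rational_vectors"
  obtain S where S: "S \<subseteq> ?R" "vec.independent S" "?R \<subseteq> vec.span S"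
    using vec.maximal_independent_subset[of ?R] by blast
  have "vec.span S = laurent_part B"
  proof
    show "vec.span S \<subseteq> laurent_part B"
      using S C by (intro vec.span_minimal) auto
    show "laurent_part B \<subseteq> vec.span S"
    proof
      fix w
      assume w: "w \<in> laurent_part B"
      show "w \<in> vec.span S"
      proof (rule subspace_closed[OF vec.subspace_span])
        fix N
        obtain v where v: "v \<in> ?R" "vanishes_below (int (nat N)) (v - w)"
          using rational_vectors_dense[OF assms w] by blast
        then have "vanishes_below N (v - w)"
          by (auto intro: vanishes_below_mono)
        with v(1) S(3) show "\<exists>v\<in>vec.span S. vanishes_below N (v - w)"
          by blast
      qed
    qed
  qed
  with S C show ?thesis
    unfolding rational_subspace_def by blast
qed

section \<open>The completion of a rational subspace\<close>

text \<open>The scalar \<open>c\<close> is a common denominator of the entries.\<close>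
lemma rational_vector_polynomial_multiple:
  fixes v :: "'a::field fls ^ 'n::finite"
  assumes "v \<in> rational_vectors"
  obtains c D where "c \<noteq> 0" "\<And>i. i < 0 \<Longrightarrow> biseries_of_fls (c *s v) i = 0"
    "\<And>i. i \<ge> int D \<Longrightarrow> biseries_of_fls (c *s v) i = 0"
proof -
  let ?e = "\<lambda>p :: 'a poly. fps_to_fls (fps_of_poly p)"
  have "\<forall>k. \<exists>p q. q \<noteq> 0 \<and> v $ k = ?e p / ?e q"
    using assms unfolding rational_vectors_def rational_fls_def by blast
  then obtain p q where pq: "\<And>k. q k \<noteq> 0" "\<And>k. v $ k = ?e (p k) / ?e (q k)"
    by metis
  define r where "r k = (\<Prod>j\<in>UNIV - {k}. q j) * p k" for k
  let ?c = "?e (prod q UNIV)"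
  have e_mult: "?e (x * y) = ?e x * ?e y" for x y
    by (simp add: fps_of_poly_mult fls_times_fps_to_fls)
  have r: "(?c *s v) $ k = ?e (r k)" for k
  proof -
    have "?c = ?e (q k) * ?e (\<Prod>j\<in>UNIV - {k}. q j)"
      by (subst prod.remove[of UNIV k]) (simp_all add: e_mult)
    then show ?thesis
      using pq(1)[of k] by (simp add: pq(2) r_def e_mult)
  qed
  define D where "D = (\<Sum>k\<in>UNIV. Suc (degree (r k)))"
  have D: "degree (r k) < D" for k
    using member_le_sum[of k UNIV "\<lambda>k. Suc (degree (r k))"] by (simp add: D_def)
  show ?thesis
  proof (rule that[of ?c D])
    show "?c \<noteq> 0"
      using pq(1) by simp
    show "biseries_of_fls (?c *s v) i = 0" if "i < 0" for i
      using that by (subst vec_eq_iff) (simp only: biseries_of_fls_nth r, simp)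
    show "biseries_of_fls (?c *s v) i = 0" if "i \<ge> int D" for i
    proof -
      have "coeff (r k) (nat i) = 0" for k
        using that D[of k] by (intro coeff_eq_0) linarith
      then show ?thesis
        using that by (subst vec_eq_iff) (simp only: biseries_of_fls_nth r, simp)
    qed
  qed
qed

text \<open>Clearing denominators turns a rational basis into a basis of polynomial vectors \<open>p\<close> of degree less
  than some \<open>D\<close>. Truncating the coordinates \<open>b\<close> of \<open>u\<close> after time \<open>t\<close> leaves \<open>u\<close> unchanged up to \<open>t\<close>,
  because \<open>p\<close> has no negative powers, and makes it vanish from \<open>t + D\<close> on.\<close>
lemma rational_subspace_steerable:
  fixes C :: "('a::field fls ^ 'n::finite) set"
  assumes "rational_subspace C"
  obtains D :: nat where
    "\<And>u t. u \<in> C \<Longrightarrow> \<exists>y\<in>C. (\<forall>i\<le>t. biseries_of_fls y i = biseries_of_fls u i) \<and>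
      (\<forall>i\<ge>t + int D. biseries_of_fls y i = 0)"
proof -
  have C: "vec.subspace C"
    using assms by (simp add: rational_subspace_def)
  obtain S where S: "S \<subseteq> rational_vectors" "vec.independent S" "vec.span S = C"
    using assms by (auto simp: rational_subspace_def)
  have "\<forall>x\<in>S. \<exists>c D. c \<noteq> 0 \<and> (\<forall>i<0. biseries_of_fls (c *s x) i = 0) \<and>
      (\<forall>i\<ge>int D. biseries_of_fls (c *s x) i = 0)"
  proof
    fix x
    assume "x \<in> S"
    with S have "x \<in> rational_vectors"
      by blast
    then show "\<exists>c D. c \<noteq> 0 \<and> (\<forall>i<0. biseries_of_fls (c *s x) i = 0) \<and>
        (\<forall>i\<ge>int D. biseries_of_fls (c *s x) i = 0)"
      by (rule rational_vector_polynomial_multiple) blast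
  qed
  then obtain c D where cD: "\<And>x. x \<in> S \<Longrightarrow> c x \<noteq> 0"
      "\<And>x i. x \<in> S \<Longrightarrow> i < 0 \<Longrightarrow> biseries_of_fls (c x *s x) i = 0"
      "\<And>x i. x \<in> S \<Longrightarrow> i \<ge> int (D x) \<Longrightarrow> biseries_of_fls (c x *s x) i = 0"
    by metis
  have "finite S"
    using S(2) by (rule vec.finiteI_independent)
  define E where "E = sum D S"
  have E: "D x \<le> E" if "x \<in> S" for x
    using member_le_sum[OF that, of D] \<open>finite S\<close> by (simp add: E_def)
  have "\<exists>y\<in>C. (\<forall>i\<le>t. biseries_of_fls y i = biseries_of_fls u i) \<and>
      (\<forall>i\<ge>t + int E. biseries_of_fls y i = 0)" if "u \<in> vec.span S" for u t
    using that
  proof (induction rule: vec.span_induct_alt)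
    case base
    show ?case
      using vec.subspace_0[OF C] by (intro bexI[of _ 0]) auto
  next
    case (step a x v)
    then obtain y where y: "y \<in> C" "\<And>i. i \<le> t \<Longrightarrow> biseries_of_fls y i = biseries_of_fls v i"
        "\<And>i. i \<ge> t + int E \<Longrightarrow> biseries_of_fls y i = 0"
      by blast
    define p where "p = c x *s x"
    define b where "b = a / c x"
    define b' where "b' = Abs_fls (\<lambda>i. if i \<le> t then fls_nth b i else 0)"
    have b': "fls_nth b' i = (if i \<le> t then fls_nth b i else 0)" for i
      unfolding b'_def
      by (rule nth_Abs_fls_ex_lower_bound) (auto intro!: exI[of _ "fls_subdegree b"])
    have ax: "a *s x = b *s p"
      using cD(1)[OF step(1)] by (simp add: b_def p_def vector_smult_assoc)
    have "p \<in> C"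
      using step(1) S(3) vec.span_base unfolding p_def by (intro vec.subspace_scale[OF C]) blast
    then have "b' *s p + y \<in> C"
      by (intro vec.subspace_add[OF C] vec.subspace_scale[OF C] y(1))
    moreover have "biseries_of_fls (b' *s p + y) i = biseries_of_fls (a *s x + v) i" if "i \<le> t" for i
    proof -
      have "vanishes_below (t + 1) ((b - b') *s p)"
      proof (rule vanishes_below_scale)
        show "vanishes_below 0 p"
          using cD(2)[OF step(1)] by (simp add: vanishes_below_def p_def)
        show "fls_nth (b - b') i = 0" if "i < t + 1" for i
          using that by (simp add: b')
      qed simp
      then have "biseries_of_fls (b *s p) i = biseries_of_fls (b' *s p) i"
        using that
        by (intro eq_if_vanishes_below_diff[of "t + 1"]) (simp_all add: vec.scale_left_diff_distrib)
      then show ?thesis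
        using y(2)[OF that] by (simp add: biseries_of_fls_add ax)
    qed
    moreover have "biseries_of_fls (b' *s p + y) i = 0" if i: "i \<ge> t + int E" for i
    proof -
      have "fls_nth (b' * p $ k) i = 0" for k
      proof (rule fls_times_nth_eq_0)
        fix j
        have "fls_nth (p $ k) (i - j) = 0" if "j \<le> t"
        proof -
          have "i - j \<ge> int (D x)"
            using that i E[OF step(1)] by linarith
          then show ?thesis
            using cD(3)[OF step(1), of "i - j"] by (metis p_def biseries_of_fls_nth zero_index)
        qed
        then show "fls_nth b' j = 0 \<or> fls_nth (p $ k) (i - j) = 0"
          by (auto simp: b')
      qed
      then show ?thesis
        using y(3)[OF i] by (simp add: biseries_of_fls_add vec_eq_iff)
    qed
    ultimately show ?case
      by blast
  qed
  then show ?thesis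
    using that S(3) by blast
qed

text \<open>Steering within \<open>C\<close> takes a time \<open>D\<close> that does not depend on the trajectory, so it survives the
  passage to the closure: a limit \<open>w\<close> of trajectories in \<open>C\<close> is steered to zero along a cluster point
  of the steered approximations.\<close>
lemma controllable_completion:
  fixes C :: "('a::{field,finite} fls ^ 'n::finite) set"
  assumes "rational_subspace C"
  shows "controllable (biseries_completion (biseries_of_fls ` C))"
proof -
  let ?B = "window_closure (biseries_of_fls ` C)"
  have C: "vec.subspace C"
    using assms by (simp add: rational_subspace_def)
  obtain D :: nat where D: "\<And>u t. u \<in> C \<Longrightarrow> \<exists>y\<in>C.
      (\<forall>i\<le>t. biseries_of_fls y i = biseries_of_fls u i) \<and> (\<forall>i\<ge>t + int D. biseries_of_fls y i = 0)"
    using rational_subspace_steerable[OF assms] by blast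
  have sub: "biseries.subspace ?B"
    using behavior_completion[OF C] by (simp add: behavior_def biseries_completion_eq_window_closure)
  have "\<exists>u\<in>?B. (\<forall>i\<le>t. u i = w i) \<and> (\<forall>i\<ge>t + int D. u i = 0)" if w: "w \<in> ?B" for w t
  proof -
    have "\<exists>y\<in>C. (\<forall>i\<in>{- int m..t}. biseries_of_fls y i = w i) \<and>
        (\<forall>i\<ge>t + int D. biseries_of_fls y i = 0)" for m
    proof -
      obtain v where "v \<in> C" "\<forall>i\<in>{- int m..t}. biseries_of_fls v i = w i"
        using window_closureD[OF w] by blast
      with D[of v t] show ?thesis
        by fastforce
    qed
    then obtain y where y: "\<And>m. y m \<in> C"
        "\<And>m i. - int m \<le> i \<Longrightarrow> i \<le> t \<Longrightarrow> biseries_of_fls (y m) i = w i"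
        "\<And>m i. i \<ge> t + int D \<Longrightarrow> biseries_of_fls (y m) i = 0"
      by (metis atLeastAtMost_iff)
    obtain u where u: "\<And>a b N. \<exists>m\<ge>N. \<forall>i\<in>{a..b}. biseries_of_fls (y m) i = u i"
      using exists_cluster_biseries[of "\<lambda>m. biseries_of_fls (y m)"] by blast
    have "u \<in> ?B"
      using u y(1) by (intro window_closureI) blast
    moreover have "u i = w i" if "i \<le> t" for i
    proof -
      obtain m where m: "m \<ge> nat (- i)" "biseries_of_fls (y m) i = u i"
        using u[of "nat (- i)" i i] by auto
      then have "- int m \<le> i"
        by linarith
      with m(2) y(2) that show ?thesis
        by simp
    qed
    moreover have "u i = 0" if "i \<ge> t + int D" for i
      using u[of 0 i i] y(3)[OF that] by auto
    ultimately show ?thesis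
      by blast
  qed
  then show ?thesis
    unfolding biseries_completion_eq_window_closure controllable_iff_steerable_to_0[OF sub] by blast
qed

text \<open>A Laurent vector \<open>v\<close> in the closure is approximated on the window \<open>[s - N, s + N]\<close> by some \<open>u \<in> C\<close>,
  which may however be nonzero far in the past. Subtracting from \<open>u\<close> its steered version removes
  what precedes \<open>s - N\<close>, at the price of an initial transient of length \<open>D\<close>. There are finitely many
  transients, so two of the resulting vectors, \<open>y N\<close> and \<open>y N'\<close>, have the same one. With
  \<open>k = N' - N\<close>, the transients cancel in \<open>y N - z^k y N'\<close>, which therefore agrees with \<open>(1 - z^k) v\<close>
  at all times up to \<open>s + N\<close>. Dividing by \<open>1 - z^k\<close> gives elements of \<open>C\<close> that converge to \<open>v\<close> as
  one-sided series, and \<open>C\<close> is closed under such limits.\<close>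
lemma laurent_part_completion:
  fixes C :: "('a::{field,finite} fls ^ 'n::finite) set"
  assumes "rational_subspace C"
  shows "laurent_part (biseries_completion (biseries_of_fls ` C)) = C"
proof
  have C: "vec.subspace C"
    using assms by (simp add: rational_subspace_def)
  show "C \<subseteq> laurent_part (biseries_completion (biseries_of_fls ` C))"
    using subset_window_closure[of "biseries_of_fls ` C"]
    by (auto simp: laurent_part_def biseries_completion_eq_window_closure)
  obtain D :: nat where D: "\<And>u t. u \<in> C \<Longrightarrow> \<exists>y\<in>C.
      (\<forall>i\<le>t. biseries_of_fls y i = biseries_of_fls u i) \<and> (\<forall>i\<ge>t + int D. biseries_of_fls y i = 0)"
    using rational_subspace_steerable[OF assms] by blast
  show "laurent_part (biseries_completion (biseries_of_fls ` C)) \<subseteq> C"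
  proof
    fix v
    assume "v \<in> laurent_part (biseries_completion (biseries_of_fls ` C))"
    then have v: "biseries_of_fls v \<in> window_closure (biseries_of_fls ` C)"
      by (simp add: laurent_part_def biseries_completion_eq_window_closure)
    obtain s where s: "\<And>i. i < s \<Longrightarrow> biseries_of_fls v i = 0"
      using exists_vanishes_below[of v] by (auto simp: vanishes_below_def)
    have "\<exists>y\<in>C. (\<forall>i<s - int N. biseries_of_fls y i = 0) \<and>
        (\<forall>i\<in>{s - int N + int D..s + int N}. biseries_of_fls y i = biseries_of_fls v i)" for N
    proof -
      obtain u where u: "u \<in> C" "\<forall>i\<in>{s - int N..s + int N}. biseries_of_fls u i = biseries_of_fls v i"
        using window_closureD[OF v] by blast
      obtain x where x: "x \<in> C" "\<forall>i\<le>s - int N - 1. biseries_of_fls x i = biseries_of_fls u i"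
          "\<forall>i\<ge>s - int N - 1 + int D. biseries_of_fls x i = 0"
        using D[OF u(1)] by blast
      show ?thesis
        using u x vec.subspace_diff[OF C u(1) x(1)]
        by (intro bexI[of _ "u - x"]) (auto simp: biseries_of_fls_diff)
    qed
    then obtain y where y: "\<And>N. y N \<in> C" "\<And>N i. i < s - int N \<Longrightarrow> biseries_of_fls (y N) i = 0"
        "\<And>N i. s - int N + int D \<le> i \<Longrightarrow> i \<le> s + int N \<Longrightarrow> biseries_of_fls (y N) i = biseries_of_fls v i"
      by (metis atLeastAtMost_iff)
    show "v \<in> C"
    proof (rule subspace_closed[OF C])
      fix K
      obtain N N' where N: "max D (nat (K - s)) \<le> N" "N < N'"
          "\<And>j. j < D \<Longrightarrow> biseries_of_fls (y N) (s - int N + int j) = biseries_of_fls (y N') (s - int N' + int j)"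
        using exists_recurrence[of "max D (nat (K - s))" D "\<lambda>N j. biseries_of_fls (y N) (s - int N + int j)"]
        by blast
      define k where "k = N' - N"
      have k: "k > 0" "int N' = int N + int k"
        using N by (auto simp: k_def)
      define u where "u = y N - fls_X ^ k *s y N'"
      have u_nth: "biseries_of_fls u i = biseries_of_fls (y N) i - biseries_of_fls (y N') (i - int k)" for i
        by (simp add: u_def vec_eq_iff fls_X_power_times_conv_shift)
      have "u \<in> C"
        unfolding u_def by (intro vec.subspace_diff[OF C] vec.subspace_scale[OF C] y)
      have "vanishes_below K (u - (1 - fls_X ^ k) *s v)"
        unfolding vanishes_below_def
      proof (intro allI impI)
        fix i
        assume i: "i < K"
        \<comment> \<open>Before the transient both sides vanish; during it the two transients cancel, and \<open>v\<close> is still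
          zero since \<open>D \<le> N\<close>; after it both vectors have reached \<open>v\<close>.\<close>
        consider "i < s - int N" | "s - int N \<le> i" "i < s - int N + int D" | "s - int N + int D \<le> i"
          by linarith
        then have "biseries_of_fls u i = biseries_of_fls v i - biseries_of_fls v (i - int k)"
        proof cases
          case 1
          then show ?thesis
            using k by (simp add: u_nth y(2) s)
        next
          case 2
          define j where "j = nat (i - (s - int N))"
          have j: "j < D" "s - int N + int j = i" "s - int N' + int j = i - int k"
            using 2 k by (auto simp: j_def)
          have "i < s"
            using 2 N(1) by linarith
          then show ?thesis
            using N(3)[OF j(1)] k unfolding j by (simp add: u_nth s)
        next
          case 3
          have "biseries_of_fls (y N) i = biseries_of_fls v i"
            using 3 i N(1) by (intro y(3)) auto
          moreover have "biseries_of_fls (y N') (i - int k) = biseries_of_fls v (i - int k)"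
            using 3 i N(1) k by (intro y(3)) auto
          ultimately show ?thesis
            by (simp add: u_nth)
        qed
        then show "biseries_of_fls (u - (1 - fls_X ^ k) *s v) i = 0"
          unfolding biseries_of_fls_diff fun_diff_def biseries_of_fls_one_minus_X_power by simp
      qed
      then have "vanishes_below K (inverse (1 - fls_X ^ k) *s u - v)"
        by (rule vanishes_below_inverse_one_minus_X_power[OF k(1)])
      then show "\<exists>u\<in>C. vanishes_below K (u - v)"
        using vec.subspace_scale[OF C \<open>u \<in> C\<close>] by blast
    qed
  qed
qed

section \<open>The largest controllable sub-behavior\<close>

lemma completion_laurent_part_subset:
  assumes "behavior B"
  shows "biseries_completion (biseries_of_fls ` laurent_part B) \<subseteq> B"
proof -
  have "window_closure (biseries_of_fls ` laurent_part B) \<subseteq> window_closure B"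
    by (intro window_closure_mono) (auto simp: laurent_part_def)
  also have "\<dots> \<subseteq> B"
    using assms by (simp add: behavior_def complete_system_iff_window_closure)
  finally show ?thesis
    by (simp add: biseries_completion_eq_window_closure)
qed

text \<open>A trajectory \<open>w\<close> in \<open>B'\<close> can be steered to zero before the window \<open>[a, b]\<close>. The difference \<open>w - u\<close>
  of \<open>w\<close> and its steered version \<open>u\<close> is zero in the far past, hence a Laurent vector, and agrees with
  \<open>w\<close> on the window.\<close>
lemma controllable_subset_completion:
  assumes B': "behavior B'" "controllable B'" and "B' \<subseteq> B"
  shows "B' \<subseteq> biseries_completion (biseries_of_fls ` laurent_part B)"
proof
  fix w
  assume w: "w \<in> B'"
  have sub: "biseries.subspace B'"
    using B' by (simp add: behavior_def)
  obtain L where L: "\<And>w t. w \<in> B' \<Longrightarrow> \<exists>u\<in>B'. (\<forall>i\<le>t. u i = w i) \<and> (\<forall>i\<ge>t + L. u i = 0)"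
    using B'(2) unfolding controllable_iff_steerable_to_0[OF sub] by blast
  show "w \<in> biseries_completion (biseries_of_fls ` laurent_part B)"
    unfolding biseries_completion_eq_window_closure
  proof (rule window_closureI)
    fix a b
    obtain u where u: "u \<in> B'" "\<forall>i\<le>a - L. u i = w i" "\<forall>i\<ge>a. u i = 0"
      using L[OF w, of "a - L"] by auto
    obtain v where v: "biseries_of_fls v = w - u"
      using biseries_of_fls_exists[of "a - L" "w - u"] u(2) by auto
    have "w - u \<in> B"
      using biseries.subspace_diff[OF sub w u(1)] assms by blast
    then have "v \<in> laurent_part B"
      by (simp add: laurent_part_def v)
    then show "\<exists>x\<in>biseries_of_fls ` laurent_part B. \<forall>i\<in>{a..b}. x i = w i"
      using u(3) by (intro bexI[OF _ imageI]) (auto simp: v)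
  qed
qed

lemma completion_laurent_part:
  assumes "behavior B" "controllable B"
  shows "biseries_completion (biseries_of_fls ` laurent_part B) = B"
  using completion_laurent_part_subset[OF assms(1)] controllable_subset_completion[OF assms order_refl]
  by (rule equalityI)

theorem theorem7p1:
  "(\<forall>B :: ('a::{field,finite}, 'n::finite) biseries set. behavior B \<longrightarrow>
      (let C = laurent_part B; Cbar = biseries_completion (biseries_of_fls ` C) in
        rational_subspace C \<and>
        behavior Cbar \<and> controllable Cbar \<and> Cbar \<subseteq> B \<and>
        (\<forall>B'. behavior B' \<and> controllable B' \<and> B' \<subseteq> B \<longrightarrow> B' \<subseteq> Cbar)))
   \<and> bij_betw (laurent_part :: ('a, 'n) biseries set \<Rightarrow> ('a fls ^ 'n) set)
       {B. behavior B \<and> controllable B} {C. rational_subspace C}"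
proof (intro conjI allI impI)
  fix B :: "('a, 'n) biseries set"
  assume B: "behavior B"
  note rational = rational_subspace_laurent_part[OF B]
  show "let C = laurent_part B; Cbar = biseries_completion (biseries_of_fls ` C) in
      rational_subspace C \<and> behavior Cbar \<and> controllable Cbar \<and> Cbar \<subseteq> B \<and>
      (\<forall>B'. behavior B' \<and> controllable B' \<and> B' \<subseteq> B \<longrightarrow> B' \<subseteq> Cbar)"
    unfolding Let_def
    using rational behavior_completion[OF subspace_laurent_part[OF B]] controllable_completion[OF rational]
      completion_laurent_part_subset[OF B] controllable_subset_completion
    by blast
next
  show "bij_betw (laurent_part :: ('a, 'n) biseries set \<Rightarrow> ('a fls ^ 'n) set)
      {B. behavior B \<and> controllable B} {C. rational_subspace C}"
    by (rule bij_betw_byWitness[where f' = "\<lambda>C. biseries_completion (biseries_of_fls ` C)"])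
      (auto simp: completion_laurent_part laurent_part_completion rational_subspace_laurent_part
        controllable_completion behavior_completion rational_subspace_def[THEN iffD1, THEN conjunct1])
qed

end
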